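(* Let $k$ be an even positive integer such that $5k+3$ is prime. If $k\equiv 1\pmod 3$ and the number $\frac{2(5k+4)}{3}$ is a period of the Fibonacci sequence modulo $5k+3$, then the following three congruences are equivalent: $$F_{5k+4}\equiv 0\pmod{5k+3},\qquad F_{\frac{5k+4}{3}}\equiv 0\pmod{5k+3},\qquad F_{\frac{2(5k+4)}{3}}\equiv 0\pmod{5k+3}.$$ Moreover, if $k\equiv 1\pmod 3$ and $F_{\frac{5k+4}{3}}\equiv 0\pmod{5k+3}$, then the number $\frac{2(5k+4)}{3}$ is a period of the Fibonacci sequence modulo $5k+3$ if and only if $F_{\frac{5k+1}{3}}\equiv -1\pmod{5k+3}$.
   Context: $(F_n)_{n\ge 0}$ denotes the Fibonacci sequence: $F_0=0$, $F_1=1$, $F_{n+2}=F_{n+1}+F_n$. For an integer $m\ge 2$, a period of the Fibonacci sequence modulo $m$ is a non-zero integer $\ell$ such that $F_{1+\ell}\equiv F_{2+\ell}\equiv 1\pmod m$. *)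

theory Defs
  imports "HOL-Number_Theory.Number_Theory"
begin

text \<open>
  The sequence is indexed by the naturals, so a period, a non-zero integer in the
  source, is taken to be a non-zero natural number. The modulus is meant to be at least 2.
\<close>

definition fib_period :: "nat \<Rightarrow> nat \<Rightarrow> bool" where
  "fib_period m l \<longleftrightarrow>
     l \<noteq> 0 \<and> [fib (1 + l) = fib (2 + l)] (mod m) \<and> [fib (2 + l) = 1] (mod m)"

end

theory Submission imports Defs begin

text \<open>
  Let \<open>p = 5 k + 3\<close> and \<open>n = (p + 1) div 3\<close>, which is even. If \<open>2 n\<close> is a period modulo \<open>p\<close>, the
  duplication formulas for \<open>F\<^bsub>2n\<^esub>\<close>, \<open>F\<^bsub>2n+1\<^esub>\<close> and Cassini's identity force \<open>p\<close> to divide \<open>F\<^sub>n\<close>, so that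
  all three congruences hold. Conversely, if \<open>p\<close> divides \<open>F\<^sub>n\<close>, then \<open>a = F\<^bsub>n-1\<^esub>\<close> is congruent to
  \<open>F\<^bsub>n+1\<^esub>\<close> and \<open>a\<^sup>2\<close> to \<open>1\<close>, so that \<open>2 n\<close> is always a period; moreover \<open>F\<^sub>p = F\<^bsub>3n-1\<^esub>\<close> is congruent
  to \<open>a\<^sup>3\<close>, hence to \<open>a\<close>. Finally \<open>F\<^sub>p\<close> is congruent to the Legendre symbol of 5 modulo \<open>p\<close>, which
  is \<open>-1\<close> by quadratic reciprocity.
\<close>

text \<open>
  In the proof, \<open>A n\<close> and \<open>B n\<close> are the coordinates of \<open>(1 + sqrt 5) ^ n\<close>
  with respect to \<open>1\<close> and \<open>sqrt 5\<close>.
\<close>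

lemma fib_binomial_sum:
  assumes "n \<le> 2 * N + 1"
  shows "2 * (\<Sum>j\<le>N. (n choose Suc (2 * j)) * 5 ^ j) = 2 ^ n * fib n"
proof -
  define A where "A m = (\<Sum>j\<le>N. (m choose (2 * j)) * 5 ^ j)" for m
  define B where "B m = (\<Sum>j\<le>N. (m choose Suc (2 * j)) * 5 ^ j)" for m
  have B_Suc: "B (Suc m) = A m + B m" for m
    by (simp add: A_def B_def sum.distrib add_mult_distrib)
  have A_Suc: "A (Suc m) = A m + 5 * B m" if "m \<le> 2 * N" for m
  proof -
    \<comment> \<open>The term at \<open>j = N\<close> vanishes because
      \<open>m < 2 * N + 1\<close>.\<close>
    have B: "B m = (\<Sum>j<N. (m choose Suc (2 * j)) * 5 ^ j)"
      using that by (simp add: B_def lessThan_Suc_atMost [symmetric])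
    have "A l = 1 + (\<Sum>j<N. (l choose Suc (Suc (2 * j))) * 5 ^ Suc j)" for l
      by (simp add: A_def lessThan_Suc_atMost [symmetric] sum.lessThan_Suc_shift
          del: sum.lessThan_Suc power_Suc binomial_Suc_Suc)
    then show ?thesis
      by (simp add: B sum.distrib distrib_left distrib_right sum_distrib_left mult_ac)
  qed
  \<comment> \<open>With the golden ratio g, \<open>(1 + sqrt 5) ^ n\<close> is \<open>2 ^ n\<close>
    times g^n = (L_n + F_n sqrt 5) / 2, where L_n is the Lucas number. Using
    \<open>A n + B n\<close> in place of \<open>A n\<close> avoids L_n.\<close>
  have "2 * B n = 2 ^ n * fib n \<and> A n + B n = 2 ^ n * fib (Suc n)"
    using assms
  proof (induction n)
    case 0
    have "A 0 = 1"
      by (simp add: A_def lessThan_Suc_atMost [symmetric] sum.lessThan_Suc_shift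
          del: sum.lessThan_Suc)
    then show ?case by (simp add: B_def)
  next
    case (Suc n)
    then have IH: "2 * B n = 2 ^ n * fib n" "A n + B n = 2 ^ n * fib (Suc n)" by auto
    have "A (Suc n) + B (Suc n) = 2 * (A n + B n) + 2 * (2 * B n)"
      using Suc.prems by (simp add: A_Suc B_Suc)
    also have "\<dots> = 2 ^ Suc n * fib (Suc (Suc n))"
      unfolding IH by (simp add: algebra_simps)
    finally show ?case using IH by (simp add: B_Suc)
  qed
  then show ?thesis
    by (simp add: B_def)
qed

text \<open>In \<open>fib_binomial_sum\<close> with \<open>N = (p - 1) div 2\<close>, every binomial
  coefficient is divisible by \<open>p\<close> except the last, which is 1 and leaves
  \<open>5 ^ N\<close>.\<close>

lemma fib_prime_cong_power:
  assumes "prime p" and "2 < p"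
  shows "[fib p = 5 ^ ((p - 1) div 2)] (mod p)"
proof -
  define N where "N = (p - 1) div 2"
  have "odd p" using assms prime_odd_nat by blast
  then have p: "p = Suc (2 * N)" by (auto simp: N_def elim: oddE)
  have "p dvd (p choose Suc (2 * j))" if "j < N" for j
    using that assms p by (intro dvd_choose_prime) auto
  then have "p dvd (\<Sum>j<N. (p choose Suc (2 * j)) * 5 ^ j)"
    by (intro dvd_sum) auto
  then have "[(\<Sum>j<N. (p choose Suc (2 * j)) * 5 ^ j) + 5 ^ N = 0 + 5 ^ N] (mod p)"
    by (intro cong_add) (auto simp: cong_0_iff)
  moreover have "(\<Sum>j\<le>N. (p choose Suc (2 * j)) * 5 ^ j)
      = (\<Sum>j<N. (p choose Suc (2 * j)) * 5 ^ j) + 5 ^ N"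
    by (simp add: lessThan_Suc_atMost [symmetric] flip: p)
  ultimately have "[2 * (\<Sum>j\<le>N. (p choose Suc (2 * j)) * 5 ^ j) = 2 * 5 ^ N] (mod p)"
    by (intro cong_mult) auto
  \<comment> \<open>\<open>2 ^ p\<close> is split so that one factor 2 cancels modulo the odd
    \<open>p\<close> and Fermat's theorem removes the others.\<close>
  then have "[2 * (2 ^ (p - 1) * fib p) = 2 * 5 ^ N] (mod p)"
    using fib_binomial_sum [of p N] p by (simp add: mult.assoc)
  moreover have "coprime 2 p" using \<open>odd p\<close> by simp
  ultimately have "[2 ^ (p - 1) * fib p = 5 ^ N] (mod p)"
    using cong_mult_lcancel_nat by blast
  moreover have "\<not> p dvd 2" using assms by (auto dest: dvd_imp_le)
  with \<open>prime p\<close> have "[2 ^ (p - 1) * fib p = 1 * fib p] (mod p)"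
    by (intro cong_mult fermat_theorem) auto
  ultimately show ?thesis
    unfolding N_def by (metis cong_sym cong_trans mult_1)
qed

lemma fib_prime_cong_Legendre:
  assumes "prime p" and "2 < p"
  shows "[int (fib p) = Legendre 5 (int p)] (mod int p)"
proof -
  have "[int (fib p) = int (5 ^ ((p - 1) div 2))] (mod int p)"
    using fib_prime_cong_power [OF assms] cong_int_iff by blast
  moreover have "[Legendre 5 (int p) = 5 ^ ((p - 1) div 2)] (mod int p)"
    using euler_criterion [of p 5] assms by simp
  ultimately show ?thesis by (simp add: cong_def)
qed

lemma Legendre_five_eq_minus_one:
  assumes "prime p" and "p mod 5 = 3"
  shows "Legendre 5 (int p) = - 1"
proof -
  have "p \<noteq> 5" using assms by auto
  have "p > 2" using assms prime_ge_2_nat [of p] by (cases "p = 2") auto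
  have "int p mod 5 = 3" using assms(2) by presburger
  \<comment> \<open>The first argument of \<open>QuadRes\<close> is the modulus. Squares modulo 5
    are 0, 1 or 4, never 3.\<close>
  have "\<not> QuadRes 5 (int p)"
  proof
    assume "QuadRes 5 (int p)"
    then obtain y :: int where y: "y\<^sup>2 mod 5 = 3"
      using \<open>int p mod 5 = 3\<close> by (auto simp: QuadRes_def cong_def)
    have "(y mod 5)\<^sup>2 mod 5 = 3" using y by (simp add: power_mod)
    moreover have "y mod 5 \<in> {0, 1, 2, 3, 4}" by auto
    ultimately show False by auto
  qed
  then have "Legendre (int p) 5 = - 1"
    using \<open>int p mod 5 = 3\<close> by (simp add: Legendre_def cong_def)
  \<comment> \<open>The factor \<open>(5 - 1) div 2 = 2\<close> makes the exponent even, so the two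
    symbols agree.\<close>
  moreover have "Legendre (int p) (int 5) * Legendre (int 5) (int p)
      = (- 1) ^ ((p - 1) div 2 * ((5 - 1) div 2))"
    using assms \<open>2 < p\<close> \<open>p \<noteq> 5\<close> by (intro Quadratic_Reciprocity) auto
  ultimately show ?thesis by simp
qed

lemma fib_duplication:
  "fib (2 * n) = fib n * (2 * fib (Suc n) - fib n)"
  "fib (Suc (2 * n)) = (fib (Suc n))\<^sup>2 + (fib n)\<^sup>2"
proof -
  show "fib (Suc (2 * n)) = (fib (Suc n))\<^sup>2 + (fib n)\<^sup>2"
    using fib_add [of n n] by (simp add: power2_eq_square mult_2)
  show "fib (2 * n) = fib n * (2 * fib (Suc n) - fib n)"
  proof (cases n)
    case (Suc m)
    then have "fib (2 * n) = fib (Suc n) * fib n + fib n * fib m"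
      using fib_add [of m n] by (simp add: mult_2 add.commute)
    also have "\<dots> = fib n * (2 * fib (Suc n) - fib n)"
      using Suc by (simp add: algebra_simps)
    finally show ?thesis .
  qed simp
qed

lemma fib_dvd: "m dvd n \<Longrightarrow> fib m dvd fib n"
  by (metis fib_gcd gcd_dvd2 gcd_nat.orderE)

lemma fib_Cassini_even:
  assumes "even n"
  shows "(int (fib (Suc n)))\<^sup>2 - int (fib (Suc n)) * int (fib n) - (int (fib n))\<^sup>2 = 1"
  using fib_Cassini_int [of n] assms by (simp add: power2_eq_square algebra_simps)

text \<open>By the recurrence, a period is a return to the initial pair (0, 1); the duplication
  formulas apply to this form.\<close>

lemma fib_period_iff:
  "fib_period m l \<longleftrightarrow> l \<noteq> 0 \<and> [fib l = 0] (mod m) \<and> [fib (Suc l) = 1] (mod m)"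
proof -
  have "[fib (1 + l) = fib (2 + l)] (mod m) \<longleftrightarrow> [fib l = 0] (mod m)"
    using cong_add_lcancel_0_nat [of "fib (Suc l)" "fib l" m]
    by (simp add: cong_sym_eq)
  moreover have "[fib (2 + l) = 1] (mod m) \<longleftrightarrow> [fib (Suc l) = 1] (mod m)"
    if "[fib (1 + l) = fib (2 + l)] (mod m)"
    using that by (simp add: cong_def)
  ultimately show ?thesis
    unfolding fib_period_def by blast
qed

text \<open>Both conditions for a period factor through x = F_n: with y = F_(n+1), \<open>p\<close>
  divides x (2y - x) and, by Cassini, x (y + 2x). If it divides both second factors, it divides
  their combination 5x.\<close>

lemma prime_dvd_fib_if_fib_period_double:
  assumes "prime p" and "p \<noteq> 5" and "even n" and "fib_period p (2 * n)"
  shows "p dvd fib n"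
proof -
  define x y P where "x = int (fib n)" and "y = int (fib (Suc n))" and "P = int p"
  have "prime P" using assms by (simp add: P_def)
  \<comment> \<open>Hence the truncated subtraction in \<open>fib_duplication\<close> agrees with
    that of the integers.\<close>
  have "fib n \<le> 2 * fib (Suc n)" using fib_Suc_mono [of n] by linarith
  then have double: "int (fib (2 * n)) = x * (2 * y - x)"
    by (simp add: fib_duplication x_def y_def)
  have "P dvd int (fib (2 * n))"
    using assms(4) by (auto simp: fib_period_iff cong_0_iff P_def)
  then have "P dvd x * (2 * y - x)" by (simp only: double)
  then consider "P dvd x" | "P dvd 2 * y - x"
    using \<open>prime P\<close> prime_dvd_mult_iff by blast
  then have "P dvd x"
  proof cases
    assume d: "P dvd 2 * y - x"
    have "[int (fib (Suc (2 * n))) = int 1] (mod P)"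
      using assms(4) unfolding P_def fib_period_iff cong_int_iff by blast
    then have "P dvd y\<^sup>2 + x\<^sup>2 - 1"
      by (simp add: fib_duplication x_def y_def cong_iff_dvd_diff)
    also have "y\<^sup>2 + x\<^sup>2 - 1 = x * (y + 2 * x)"
      using fib_Cassini_even [OF \<open>even n\<close>]
      by (simp add: x_def y_def power2_eq_square algebra_simps)
    finally consider "P dvd x" | "P dvd y + 2 * x"
      using \<open>prime P\<close> prime_dvd_mult_iff by blast
    then show ?thesis
    proof cases
      assume "P dvd y + 2 * x"
      then have "P dvd 2 * (y + 2 * x) - (2 * y - x)"
        using d dvd_diff dvd_mult by blast
      then have "P dvd 5 * x" by simp
      moreover have "\<not> P dvd 5"
      proof
        assume "P dvd 5"
        then have "int p dvd int 5" by (simp add: P_def)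
        then have "p dvd 5" unfolding of_nat_dvd_iff .
        then show False
          using assms(1,2) primes_dvd_imp_eq [of p 5] by simp
      qed
      ultimately show ?thesis
        using \<open>prime P\<close> prime_dvd_mult_iff by blast
    qed
  qed
  then show ?thesis by (simp add: x_def P_def)
qed

text \<open>Expanding by the addition formula leaves \<open>int (fib m) ^ 3\<close> plus a multiple
  of \<open>int (fib (Suc m))\<close>.\<close>

lemma fib_triple_pred_cong:
  assumes "[int (fib (Suc m)) = 0] (mod P)"
  shows "[int (fib (3 * m + 2)) = int (fib m) ^ 3] (mod P)"
proof -
  define x a where "x = int (fib (Suc m))" and "a = int (fib m)"
  have 1: "int (fib (Suc (2 * m))) = x\<^sup>2 + a\<^sup>2"
    by (simp add: fib_duplication x_def a_def)
  have 2: "int (fib (Suc (Suc (2 * m)))) = x * (x + 2 * a)"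
  proof -
    have "Suc (Suc (2 * m)) = Suc (m + Suc m)" by simp
    then have "fib (Suc (Suc (2 * m))) = fib (Suc (Suc m)) * fib (Suc m) + fib (Suc m) * fib m"
      by (simp only: fib_add)
    also have "\<dots> = fib (Suc m) * (fib (Suc m) + 2 * fib m)"
      by (simp add: algebra_simps)
    finally show ?thesis by (simp only: x_def a_def of_nat_mult of_nat_add of_nat_numeral)
  qed
  have "3 * m + 2 = Suc (Suc (2 * m) + m)" by simp
  then have "fib (3 * m + 2)
      = fib (Suc m) * fib (Suc (Suc (2 * m))) + fib m * fib (Suc (2 * m))"
    by (simp only: fib_add)
  then have "int (fib (3 * m + 2)) = x * (x * (x + 2 * a)) + a * (x\<^sup>2 + a\<^sup>2)"
    by (simp only: of_nat_mult of_nat_add 1 2) (simp only: x_def a_def)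
  then have "int (fib (3 * m + 2)) - a ^ 3 = x * (x * (x + 2 * a) + a * x)"
    by (simp add: power2_eq_square power3_eq_cube algebra_simps)
  moreover have "P dvd x" using assms by (simp add: x_def cong_0_iff)
  ultimately show ?thesis
    unfolding cong_iff_dvd_diff a_def by simp
qed

theorem theorem5p37:
  fixes k :: nat
  assumes "even k" and "k > 0" and "prime (5 * k + 3)"
  shows "([k = 1] (mod 3) \<and> fib_period (5 * k + 3) (2 * (5 * k + 4) div 3) \<longrightarrow>
            ([fib (5 * k + 4) = 0] (mod (5 * k + 3)) \<longleftrightarrow>
               [fib ((5 * k + 4) div 3) = 0] (mod (5 * k + 3))) \<and>
            ([fib ((5 * k + 4) div 3) = 0] (mod (5 * k + 3)) \<longleftrightarrow>
               [fib (2 * (5 * k + 4) div 3) = 0] (mod (5 * k + 3))))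
       \<and> ([k = 1] (mod 3) \<and> [fib ((5 * k + 4) div 3) = 0] (mod (5 * k + 3)) \<longrightarrow>
            (fib_period (5 * k + 3) (2 * (5 * k + 4) div 3) \<longleftrightarrow>
               [int (fib ((5 * k + 1) div 3)) = - 1] (mod int (5 * k + 3))))"
proof (cases "[k = 1] (mod 3)")
  case True
  define p where "p = 5 * k + 3"
  have "prime p" "2 < p" "p \<noteq> 5" "p mod 5 = 3"
    using assms by (auto simp: p_def)
  \<comment> \<open>The index \<open>m\<close> is n - 1, which keeps all indices free of
    subtraction.\<close>
  define m where "m = (5 * k + 1) div 3"
  have "k mod 3 = 1" using True by (simp add: cong_def)
  then have m: "5 * k + 1 = 3 * m" unfolding m_def by presburger
  have n: "(5 * k + 4) div 3 = Suc m" "2 * (5 * k + 4) div 3 = 2 * Suc m"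
    "5 * k + 4 = Suc m * 3" "p = 3 * m + 2"
    using m by (auto simp: p_def)
  have "even (Suc m)" using m \<open>even k\<close> by presburger
  have "p dvd fib (Suc m)" if "fib_period p (2 * Suc m)"
    using prime_dvd_fib_if_fib_period_double \<open>prime p\<close> \<open>p \<noteq> 5\<close> \<open>even (Suc m)\<close> that by blast
  \<comment> \<open>Both sides of the final equivalence are proved outright from
    \<open>p dvd fib (Suc m)\<close>.\<close>
  moreover have "fib_period p (2 * Suc m) \<and> [int (fib m) = - 1] (mod int p)"
    if *: "p dvd fib (Suc m)"
  proof
    define x a where "x = int (fib (Suc m))" and "a = int (fib m)"
    have x: "int p dvd x" using * by (simp add: x_def)
    \<comment> \<open>Here \<open>x + a\<close> is F_(m+2), and \<open>Suc m\<close> being even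
      gives Cassini's identity the sign +1.\<close>
    have "(x + a)\<^sup>2 - (x + a) * x - x\<^sup>2 = 1"
      using fib_Cassini_even [OF \<open>even (Suc m)\<close>] by (simp add: x_def a_def)
    then have "a\<^sup>2 - 1 = x * (x - a)" by (simp add: power2_eq_square algebra_simps)
    with x have a2: "int p dvd a\<^sup>2 - 1" by simp
    have "int (fib (Suc (2 * Suc m))) - int 1 = x * (2 * x + 2 * a) + (a\<^sup>2 - 1)"
      unfolding fib_duplication by (simp add: x_def a_def power2_eq_square algebra_simps)
    with x a2 have "[int (fib (Suc (2 * Suc m))) = int 1] (mod int p)"
      unfolding cong_iff_dvd_diff by (simp only: dvd_add dvd_mult2)
    then have "[fib (Suc (2 * Suc m)) = 1] (mod p)"
      unfolding cong_int_iff .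
    moreover have "[fib (2 * Suc m) = 0] (mod p)"
      unfolding fib_duplication using * by (simp add: cong_0_iff)
    ultimately show "fib_period p (2 * Suc m)" by (simp add: fib_period_iff)
    have "[int (fib (Suc m)) = 0] (mod int p)" using * by (simp add: cong_0_iff)
    from fib_triple_pred_cong [OF this] have "[int (fib p) = a ^ 3] (mod int p)"
      by (simp only: a_def flip: n(4))
    moreover have "[a ^ 3 = a] (mod int p)"
    proof -
      have "a ^ 3 - a = a * (a\<^sup>2 - 1)"
        by (simp add: power2_eq_square power3_eq_cube algebra_simps)
      with a2 show ?thesis by (simp add: cong_iff_dvd_diff)
    qed
    moreover have "[int (fib p) = - 1] (mod int p)"
      using fib_prime_cong_Legendre [OF \<open>prime p\<close> \<open>2 < p\<close>]
        Legendre_five_eq_minus_one [OF \<open>prime p\<close> \<open>p mod 5 = 3\<close>] by simp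
    ultimately show "[int (fib m) = - 1] (mod int p)"
      by (simp add: cong_def a_def)
  qed
  \<comment> \<open>F_n divides F_(2n) and F_(3n), so \<open>p dvd fib (Suc m)\<close> yields the
    other two congruences.\<close>
  moreover have "fib (Suc m) dvd fib (5 * k + 4)" "fib (Suc m) dvd fib (2 * Suc m)"
    unfolding n(3) by (intro fib_dvd dvd_triv_left dvd_triv_right)+
  ultimately show ?thesis
    unfolding n(1,2) m_def [symmetric] p_def [symmetric] cong_0_iff
    by (meson dvd_trans)
next
  case False
  then show ?thesis by simp
qed

end
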